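(* Let $S_{--}$ be the $|\gamma^-|\times|\gamma^-|$ matrix with entries $h^2G^h_{\bm m-\bm n}$, $\bm m,\bm n\in\gamma^-$. Assume that $S_{--}$ is nonsingular and that the interior lattice Dirichlet problem on $M^+$ with prescribed values on $\gamma^-$ is uniquely solvable, i.e. for every $\eta:\gamma^-\to\mathbb{C}$ there is exactly one $u:N^+\to\mathbb{C}$ with $L^hu=0$ on $M^+$ and $u|_{\gamma^-}=\eta$. Let $f^{h,-}$ be a finitely supported source vector with $\operatorname{supp}f^{h,-}\subseteq M^-$, let $u^{h,-}=G^h\ast f^{h,-}$, and suppose that there is no interior source ($f^{h,+}=0$). Let $\xi_{\gamma^-}=u^{h,-}|_{\gamma^-}$ and set $$\lambda_-=S_{--}^{-1}\xi_{\gamma^-},\qquad v^h=G^h\ast\lambda_-,$$ where $\lambda_-$ is extended by zero away from $\gamma^-$. Then $v^h|_{N^+}=u^{h,-}|_{N^+}$, and the control $g^h_-$ given by $g^h_-=-\lambda_-$ on $\gamma^-$ and $g^h_-=0$ elsewhere produces a controlled field $\widetilde u^h=G^h\ast(f^{h,-}+g^h_-)$ with $$\widetilde u^h|_{N^+}=0.$$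
   Context: Lattice and operator. Let $d\in\{2,3\}$, $h>0$, wavenumber $k>0$. Functions on the lattice $\Lambda_h=h\mathbb{Z}^d$ are indexed by $\mathbb{Z}^d$ (node $h\bm m\leftrightarrow\bm m$). The discrete Helmholtz operator is $$(L^hv)_{\bm m}=-\frac1{h^2}\sum_{\bm e\in\mathbb{Z}^d,\,|\bm e|_1=1}(v_{\bm m+\bm e}-v_{\bm m})-k^2v_{\bm m}.$$ Geometry. $\Omega_{\rm in}\subset\mathbb{R}^d$ is a bounded Lipschitz domain, $M^+=\{\bm m\in\mathbb{Z}^d: h\bm m\in\Omega_{\rm in}\}$, $M^-=\{\bm m\in\mathbb{Z}^d: h\bm m\notin\overline{\Omega_{\rm in}}\}$, and no lattice node lies on $\partial\Omega_{\rm in}$, so $\mathbb{Z}^d=M^+\sqcup M^-$. $N^\pm$ is the set of all nodes of the stencils of $L^h$ centred in $M^\pm$: $N^\pm=M^\pm\cup\{\bm m+\bm e:\bm m\in M^\pm,|\bm e|_1=1\}$. The boundary strip is $\gamma=N^+\cap N^-$, with $\gamma^\pm=\gamma\cap M^\pm$ (so $N^+=M^+\cup\gamma^-$). Lattice Green's function. $$G^h_{\bm m}=\frac1{(2\pi)^d}\int_{[-\pi,\pi]^d}\frac{e^{i\bm m\cdot\bm\theta}}{\sigma(\bm\theta)-k^2h^2+i0^+}\,d\bm\theta,\qquad \sigma(\bm\theta)=\sum_{j=1}^d2(1-\cos\theta_j),$$ where $i0^+$ means the limit $\varepsilon\to0^+$ with $i\varepsilon$ in place of $i0^+$; $(h,k)$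 are assumed such that the limit exists. Then $L^hG^h=h^{-2}\delta_{\bm 0}$. For finitely supported $f$, $(G^h\ast f)_{\bm m}=h^2\sum_{\bm n}G^h_{\bm m-\bm n}f_{\bm n}$, so $L^h(G^h\ast f)=f$; $G^h\ast f$ is called the outgoing solution generated by $f$. *)

theory Defs
  imports "HOL-Analysis.Analysis"
begin

text \<open>A bounded open connected set that, near each of its boundary points, is the strict
  epigraph of a Lipschitz function in some orthonormal coordinate system: \<open>\<nu>\<close> is the unit
  vector of the last coordinate axis, and \<open>y - (y \<bullet> \<nu>) *\<^sub>R \<nu>\<close> collects the remaining
  coordinates of \<open>y\<close>, so that \<open>\<phi>\<close> is a function on the hyperplane orthogonal to \<open>\<nu>\<close>.\<close>

definition bounded_lipschitz_domain :: "'a::euclidean_space set \<Rightarrow> bool" where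
  "bounded_lipschitz_domain \<Omega> \<longleftrightarrow>
     \<Omega> \<noteq> {} \<and> open \<Omega> \<and> connected \<Omega> \<and> bounded \<Omega> \<and>
     (\<forall>x\<in>frontier \<Omega>. \<exists>\<nu> \<phi> C r. norm \<nu> = 1 \<and> r > 0 \<and> C-lipschitz_on {z. z \<bullet> \<nu> = 0} \<phi> \<and>
        \<Omega> \<inter> ball x r = {y \<in> ball x r. \<phi> (y - (y \<bullet> \<nu>) *\<^sub>R \<nu>) < y \<bullet> \<nu>})"

definition unit_steps :: "(int ^ 'd) set" where
  "unit_steps = {e. (\<Sum>i\<in>UNIV. \<bar>e $ i\<bar>) = 1}"

definition discrete_helmholtz ::
  "real \<Rightarrow> real \<Rightarrow> (int ^ 'd \<Rightarrow> complex) \<Rightarrow> int ^ 'd \<Rightarrow> complex" where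
  "discrete_helmholtz h k v m =
     - (1 / of_real (h\<^sup>2)) * (\<Sum>e\<in>unit_steps. v (m + e) - v m) - of_real (k\<^sup>2) * v m"

definition lattice_node :: "real \<Rightarrow> int ^ 'd \<Rightarrow> real ^ 'd" where
  "lattice_node h m = h *\<^sub>R (\<chi> i. of_int (m $ i))"

definition M_plus :: "real \<Rightarrow> (real ^ 'd) set \<Rightarrow> (int ^ 'd) set" where
  "M_plus h \<Omega> = {m. lattice_node h m \<in> \<Omega>}"

definition M_minus :: "real \<Rightarrow> (real ^ 'd) set \<Rightarrow> (int ^ 'd) set" where
  "M_minus h \<Omega> = {m. lattice_node h m \<notin> closure \<Omega>}"

definition stencil_nodes :: "(int ^ 'd) set \<Rightarrow> (int ^ 'd) set" where
  "stencil_nodes M = M \<union> {m + e | m e. m \<in> M \<and> e \<in> unit_steps}"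

definition N_plus :: "real \<Rightarrow> (real ^ 'd) set \<Rightarrow> (int ^ 'd) set" where
  "N_plus h \<Omega> = stencil_nodes (M_plus h \<Omega>)"

definition N_minus :: "real \<Rightarrow> (real ^ 'd) set \<Rightarrow> (int ^ 'd) set" where
  "N_minus h \<Omega> = stencil_nodes (M_minus h \<Omega>)"

definition boundary_strip :: "real \<Rightarrow> (real ^ 'd) set \<Rightarrow> (int ^ 'd) set" where
  "boundary_strip h \<Omega> = N_plus h \<Omega> \<inter> N_minus h \<Omega>"

definition gamma_minus :: "real \<Rightarrow> (real ^ 'd) set \<Rightarrow> (int ^ 'd) set" where
  "gamma_minus h \<Omega> = boundary_strip h \<Omega> \<inter> M_minus h \<Omega>"

definition lattice_symbol :: "real ^ 'd \<Rightarrow> real" where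
  "lattice_symbol \<theta> = (\<Sum>j\<in>UNIV. 2 * (1 - cos (\<theta> $ j)))"

definition regularized_green :: "real \<Rightarrow> real \<Rightarrow> real \<Rightarrow> int ^ 'd \<Rightarrow> complex" where
  "regularized_green h k \<epsilon> m =
     1 / of_real ((2 * pi) ^ CARD('d)) *
     integral (cbox (\<chi> i. - pi) (\<chi> i. pi))
       (\<lambda>\<theta>::real ^ 'd. exp (\<i> * of_real (\<Sum>j\<in>UNIV. of_int (m $ j) * \<theta> $ j)) /
             (of_real (lattice_symbol \<theta> - k\<^sup>2 * h\<^sup>2) + \<i> * of_real \<epsilon>))"

definition green_limit_exists :: "'d::finite itself \<Rightarrow> real \<Rightarrow> real \<Rightarrow> bool" where
  "green_limit_exists TYPE('d) h k \<longleftrightarrow>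
     (\<forall>m :: int ^ 'd. \<exists>l. ((\<lambda>\<epsilon>. regularized_green h k \<epsilon> m) \<longlongrightarrow> l) (at_right 0))"

text \<open>Only meaningful when the limit exists.\<close>

definition lattice_green :: "real \<Rightarrow> real \<Rightarrow> int ^ 'd \<Rightarrow> complex" where
  "lattice_green h k m = Lim (at_right 0) (\<lambda>\<epsilon>. regularized_green h k \<epsilon> m)"

definition lattice_support :: "(int ^ 'd \<Rightarrow> complex) \<Rightarrow> (int ^ 'd) set" where
  "lattice_support f = {n. f n \<noteq> 0}"

text \<open>The convolution of the Green's function with a finitely supported \<open>f\<close>; summing over the
  support of \<open>f\<close> gives the sum over all of the lattice. For infinite support it is junk.\<close>

definition outgoing_solution ::
  "real \<Rightarrow> real \<Rightarrow> (int ^ 'd \<Rightarrow> complex) \<Rightarrow> int ^ 'd \<Rightarrow> complex" where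
  "outgoing_solution h k f m =
     of_real (h\<^sup>2) * (\<Sum>n\<in>lattice_support f. lattice_green h k (m - n) * f n)"

text \<open>Square matrices whose rows and columns are indexed by a finite set \<open>I\<close> are functions
  of two arguments, of which only the values on \<open>I \<times> I\<close> matter.\<close>

definition inverse_matrix_on ::
  "'i set \<Rightarrow> ('i \<Rightarrow> 'i \<Rightarrow> complex) \<Rightarrow> ('i \<Rightarrow> 'i \<Rightarrow> complex) \<Rightarrow> bool" where
  "inverse_matrix_on I A B \<longleftrightarrow>
     (\<forall>i\<in>I. \<forall>j\<in>I. (\<Sum>l\<in>I. A i l * B l j) = (if i = j then 1 else 0)) \<and>
     (\<forall>i\<in>I. \<forall>j\<in>I. (\<Sum>l\<in>I. B i l * A l j) = (if i = j then 1 else 0))"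

definition nonsingular_on :: "'i set \<Rightarrow> ('i \<Rightarrow> 'i \<Rightarrow> complex) \<Rightarrow> bool" where
  "nonsingular_on I A \<longleftrightarrow> (\<exists>B. inverse_matrix_on I A B)"

text \<open>For nonsingular \<open>A\<close> and finite \<open>I\<close> the values of the inverse on \<open>I \<times> I\<close> do not depend on
  the choice.\<close>

definition matrix_inv_on :: "'i set \<Rightarrow> ('i \<Rightarrow> 'i \<Rightarrow> complex) \<Rightarrow> 'i \<Rightarrow> 'i \<Rightarrow> complex" where
  "matrix_inv_on I A = (SOME B. inverse_matrix_on I A B)"

text \<open>The product vector is extended by zero outside \<open>I\<close>.\<close>

definition matrix_vec_on ::
  "'i set \<Rightarrow> ('i \<Rightarrow> 'i \<Rightarrow> complex) \<Rightarrow> ('i \<Rightarrow> complex) \<Rightarrow> 'i \<Rightarrow> complex" where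
  "matrix_vec_on I A x i = (if i \<in> I then \<Sum>j\<in>I. A i j * x j else 0)"

definition S_minus_minus ::
  "real \<Rightarrow> real \<Rightarrow> int ^ 'd \<Rightarrow> int ^ 'd \<Rightarrow> complex" where
  "S_minus_minus h k m n = of_real (h\<^sup>2) * lattice_green h k (m - n)"

text \<open>Functions on \<open>N\<^sup>+\<close> are represented by the elements of \<open>extensional\<close>, so that uniqueness
  is uniqueness of the values on \<open>N\<^sup>+\<close>; on \<open>M\<^sup>+\<close> the operator reads only these values.\<close>

definition interior_dirichlet_uniquely_solvable ::
  "real \<Rightarrow> real \<Rightarrow> (real ^ 'd) set \<Rightarrow> bool" where
  "interior_dirichlet_uniquely_solvable h k \<Omega> \<longleftrightarrow>
     (\<forall>\<eta>. \<exists>!u. u \<in> extensional (N_plus h \<Omega>) \<and>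
            (\<forall>m\<in>M_plus h \<Omega>. discrete_helmholtz h k u m = 0) \<and>
            (\<forall>m\<in>gamma_minus h \<Omega>. u m = \<eta> m))"

end

theory Submission imports Defs begin

text \<open>The Green's function satisfies \<open>L\<^sup>h G\<^sup>h = 0\<close> away from the origin: for \<open>\<epsilon> > 0\<close>, applying
  \<open>L\<^sup>h\<close> multiplies the integrand by \<open>\<sigma> - k\<^sup>2h\<^sup>2\<close>, which cancels the denominator up to a multiple of
  \<open>\<epsilon>\<close>, and the integral of a nontrivial character over the torus vanishes. Hence outgoing solutions
  generated by sources in \<open>M\<^sup>-\<close> solve the homogeneous equation on \<open>M\<^sup>+\<close>. Both \<open>u\<^sup>h\<^sup>-\<close> and
  \<open>G\<^sup>h \<ast> \<lambda>\<^sub>-\<close> are of this kind, and they agree on \<open>\<gamma>\<^sup>-\<close> by the choice of \<open>\<lambda>\<^sub>-\<close>, so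
  uniqueness for the interior Dirichlet problem identifies them on \<open>N\<^sup>+\<close>. The controlled field is
  their difference.\<close>

section \<open>Unit steps and the lattice symbol\<close>

text \<open>A nonzero integer coordinate has absolute value at least 1, so it exhausts the total 1
  and all the other coordinates vanish.\<close>

lemma unit_steps_eq:
  "(unit_steps :: (int ^ 'd) set) = (\<lambda>j. axis j 1) ` UNIV \<union> (\<lambda>j. axis j (-1)) ` UNIV"
proof (intro equalityI subsetI)
  fix e :: "int ^ 'd"
  assume "e \<in> unit_steps"
  then have sum: "(\<Sum>i\<in>UNIV. \<bar>e $ i\<bar>) = 1"
    by (simp add: unit_steps_def)
  then obtain j where j: "e $ j \<noteq> 0"
    by (metis (mono_tags, lifting) abs_0 sum.neutral zero_neq_one)
  have "\<bar>e $ j\<bar> + (\<Sum>i\<in>UNIV - {j}. \<bar>e $ i\<bar>) = 1"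
    using sum by (simp add: sum.remove[of UNIV j])
  moreover have "(\<Sum>i\<in>UNIV - {j}. \<bar>e $ i\<bar>) \<ge> 0"
    by (simp add: sum_nonneg)
  ultimately have *: "\<bar>e $ j\<bar> = 1" "(\<Sum>i\<in>UNIV - {j}. \<bar>e $ i\<bar>) = 0"
    using j by linarith+
  then have "e $ i = 0" if "i \<noteq> j" for i
    using that by (subst (asm) sum_nonneg_eq_0_iff) auto
  then have "e = axis j (e $ j)"
    by (auto simp: vec_eq_iff axis_def)
  moreover have "e $ j = 1 \<or> e $ j = -1"
    using *(1) by linarith
  ultimately show "e \<in> (\<lambda>j. axis j 1) ` UNIV \<union> (\<lambda>j. axis j (-1)) ` UNIV"
    by (metis UnI1 UnI2 rangeI)
next
  fix e :: "int ^ 'd"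
  assume "e \<in> (\<lambda>j. axis j 1) ` UNIV \<union> (\<lambda>j. axis j (-1)) ` UNIV"
  then show "e \<in> unit_steps"
    by (auto simp: unit_steps_def axis_def if_distrib[where f = abs] cong: if_cong)
qed

lemma finite_unit_steps: "finite (unit_steps :: (int ^ 'd) set)"
  by (simp add: unit_steps_eq)

text \<open>Opposite steps are paired so that their two exponentials can later combine into a
  cosine.\<close>

lemma sum_unit_steps:
  fixes f :: "int ^ 'd \<Rightarrow> 'a::comm_monoid_add"
  shows "(\<Sum>e\<in>unit_steps. f e) = (\<Sum>j\<in>UNIV. f (axis j 1) + f (axis j (-1)))"
proof -
  have "(\<Sum>e\<in>unit_steps. f e) =
      (\<Sum>e\<in>range (\<lambda>j. axis j 1). f e) + (\<Sum>e\<in>range (\<lambda>j. axis j (-1)). f e)"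
    unfolding unit_steps_eq by (rule sum.union_disjoint) (auto simp: axis_eq_axis)
  also have "\<dots> = (\<Sum>j\<in>UNIV. f (axis j 1)) + (\<Sum>j\<in>UNIV. f (axis j (-1)))"
    by (simp add: sum.reindex inj_on_def axis_eq_axis)
  finally show ?thesis
    by (simp add: sum.distrib)
qed

text \<open>The exponential factor in the integrand of \<open>regularized_green\<close>. For fixed
  \<theta> it is multiplicative in \<open>m\<close>, hence an eigenfunction of every lattice
  shift.\<close>

definition lattice_char :: "int ^ 'd \<Rightarrow> real ^ 'd \<Rightarrow> complex" where
  "lattice_char m \<theta> = exp (\<i> * of_real (\<Sum>j\<in>UNIV. of_int (m $ j) * \<theta> $ j))"

lemma lattice_char_add: "lattice_char (m + n) \<theta> = lattice_char m \<theta> * lattice_char n \<theta>"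
  by (simp add: lattice_char_def algebra_simps sum.distrib flip: exp_add)

lemma lattice_char_axis: "lattice_char (axis j a) \<theta> = cis (of_int a * \<theta> $ j)"
proof -
  have "(\<Sum>i\<in>UNIV. of_int ((axis j a :: int ^ 'a) $ i) * \<theta> $ i)
      = (\<Sum>i\<in>UNIV. if i = j then of_int a * \<theta> $ j else 0)"
    by (rule sum.cong) (auto simp: axis_def)
  then show ?thesis
    by (simp add: lattice_char_def cis_conv_exp)
qed

text \<open>Each shift multiplies the character by a factor free of \<open>m\<close>; the pair of
  steps along axis \<open>j\<close> contributes exp(i t) + exp(-i t) - 2 = -2 (1 - cos t) with t the
  \<open>j\<close>-th coordinate of \<theta>.\<close>

lemma sum_unit_steps_lattice_char:
  "(\<Sum>e\<in>unit_steps. lattice_char (m + e) \<theta> - lattice_char m \<theta>)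
     = - of_real (lattice_symbol \<theta>) * lattice_char m \<theta>"
proof -
  have "(\<Sum>e\<in>unit_steps. lattice_char (m + e) \<theta> - lattice_char m \<theta>)
      = (\<Sum>e\<in>unit_steps. lattice_char e \<theta> - 1) * lattice_char m \<theta>"
    unfolding lattice_char_add sum_distrib_right by (rule sum.cong) (simp_all add: algebra_simps)
  also have "(\<Sum>e\<in>unit_steps. lattice_char e \<theta> - 1)
      = (\<Sum>j\<in>UNIV. (cis (\<theta> $ j) - 1) + (cis (- \<theta> $ j) - 1))"
    by (simp add: sum_unit_steps lattice_char_axis)
  also have "\<dots> = (\<Sum>j\<in>UNIV. of_real (- (2 * (1 - cos (\<theta> $ j)))))"
    by (rule sum.cong) (auto simp: complex_eq_iff)
  also have "\<dots> = - of_real (lattice_symbol \<theta>)"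
    by (simp only: lattice_symbol_def of_real_sum sum_negf of_real_minus)
  finally show ?thesis .
qed

section \<open>The equation for the Green's function\<close>

lemma integral_exp_int_frequency:
  fixes a :: int
  assumes "a \<noteq> 0"
  shows "(LINT t:{-pi..pi}|lborel. exp (\<i> * of_real (of_int a * t))) = 0"
proof -
  let ?f = "\<lambda>t::real. exp (\<i> * of_real (of_int a * t))"
  have "continuous_on {-pi..pi} ?f"
    by (intro continuous_intros)
  then have "set_integrable lborel {-pi..pi} ?f"
    by (rule borel_integrable_atLeastAtMost')
  then have "(LINT t:{-pi..pi}|lborel. ?f t) = integral {-pi..pi} ?f"
    by (rule set_borel_integral_eq_integral)
  moreover have "(?f has_integral (?f pi / (\<i> * of_int a) - ?f (-pi) / (\<i> * of_int a))) {-pi..pi}"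
  proof (rule fundamental_theorem_of_calculus)
    fix t :: real
    have "((\<lambda>z. exp (\<i> * (of_int a * z)) / (\<i> * of_int a)) has_field_derivative
        exp (\<i> * (of_int a * of_real t))) (at (of_real t))"
      using assms by (auto intro!: derivative_eq_intros simp: field_simps)
    from has_vector_derivative_real_field[OF this]
    show "((\<lambda>t. ?f t / (\<i> * of_int a)) has_vector_derivative ?f t) (at t within {-pi..pi})"
      by simp
  qed simp
  moreover have "?f pi = ?f (-pi)"
  proof -
    \<comment> \<open>The exponents at the two endpoints differ by 2 pi i times the integer
      \<open>a\<close>, so the antiderivative has equal end values.\<close>
    have "?f pi = exp (\<i> * of_real (of_int a * -pi) + 2 * of_int a * pi * \<i>)"
      by (simp add: algebra_simps)
    also have "\<dots> = ?f (-pi)"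
      by (rule exp_eq[THEN iffD2]) (auto intro!: exI[of _ a])
    finally show ?thesis .
  qed
  ultimately show ?thesis
    by (simp add: integral_unique)
qed

text \<open>Fubini for separated variables: \<open>lborel\<close> is the image of a product measure
  indexed by \<open>Basis\<close> under the map that assembles a vector from its
  coordinates.\<close>

lemma lborel_integral_prod_Basis:
  fixes f :: "'a::euclidean_space \<Rightarrow> real \<Rightarrow> 'b::{real_normed_field, banach, second_countable_topology}"
  assumes int: "\<And>b. b \<in> Basis \<Longrightarrow> integrable lborel (f b)"
  shows "(\<integral>x. (\<Prod>b\<in>Basis. f b (x \<bullet> b)) \<partial>lborel) = (\<Prod>b\<in>Basis. \<integral>x. f b x \<partial>lborel)"
proof -
  interpret product_sigma_finite "\<lambda>b::'a. lborel :: real measure" ..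
  have [measurable]: "f b \<in> borel_measurable borel" if "b \<in> Basis" for b
    using int[OF that] by (simp add: borel_measurable_integrable)
  have "(\<integral>x. (\<Prod>b\<in>Basis. f b (x \<bullet> b)) \<partial>lborel)
      = (\<integral>x. (\<Prod>b\<in>Basis. f b ((\<Sum>b\<in>Basis. x b *\<^sub>R b) \<bullet> b)) \<partial>(\<Pi>\<^sub>M b\<in>Basis. lborel))"
    by (subst lborel_eq, subst integral_distr) simp_all
  also have "\<dots> = (\<integral>x. (\<Prod>b\<in>Basis. f b (x b)) \<partial>(\<Pi>\<^sub>M b\<in>Basis. lborel))"
    by simp
  also have "\<dots> = (\<Prod>b\<in>Basis. \<integral>x. f b x \<partial>lborel)"
    by (rule product_integral_prod) (use int in auto)
  finally show ?thesis .
qed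

lemma prod_Basis_cart:
  fixes f :: "real ^ 'd \<Rightarrow> 'a::comm_monoid_mult"
  shows "(\<Prod>b\<in>Basis. f b) = (\<Prod>j\<in>UNIV. f (axis j 1))"
proof -
  have Basis: "(Basis :: (real ^ 'd) set) = range (\<lambda>j. axis j 1)"
    by (auto simp: Basis_vec_def)
  have "inj (\<lambda>j::'d. axis j (1::real))"
    by (simp add: inj_on_def axis_eq_axis)
  from prod.reindex[OF this, of f] show ?thesis
    unfolding Basis by (simp add: o_def)
qed

lemma continuous_on_lattice_char [continuous_intros]: "continuous_on S (lattice_char m)"
  unfolding lattice_char_def by (intro continuous_intros)

text \<open>The integral over the cube factors into one-dimensional integrals, and a coordinate with
  nonzero frequency makes its factor vanish.\<close>

lemma integral_lattice_char:
  fixes m :: "int ^ 'd"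
  assumes "m \<noteq> 0"
  shows "integral (cbox (\<chi> i. - pi) (\<chi> i. pi)) (lattice_char m) = 0"
proof -
  let ?Q = "cbox (\<chi> i. - pi) (\<chi> i. pi) :: (real ^ 'd) set"
  \<comment> \<open>The product formula needs factors indexed by basis vectors, so the sum with the
    conditional recovers \<open>m $ j\<close> from \<open>b = axis j 1\<close>. The indicator is
    built in because that formula integrates over the whole space.\<close>
  define F where "F b t = indicator {-pi..pi} t *\<^sub>R
      exp (\<i> * of_real (of_int (\<Sum>j\<in>UNIV. m $ j * (if b = axis j 1 then 1 else 0)) * t))"
    for b :: "real ^ 'd" and t :: real
  have F_axis: "F (axis j 1) t =
      indicator {-pi..pi} t *\<^sub>R exp (\<i> * of_real (of_int (m $ j) * t))" for j t
    by (simp add: F_def axis_eq_axis if_distrib sum.delta cong: if_cong)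
  have int: "integrable lborel (F b)" for b
    unfolding F_def
    by (intro borel_integrable_atLeastAtMost'[unfolded set_integrable_def] continuous_intros)
  obtain j where j: "m $ j \<noteq> 0"
    using assms by (auto simp: vec_eq_iff)
  have eq: "(\<Prod>b\<in>Basis. F b (\<theta> \<bullet> b)) = indicator ?Q \<theta> *\<^sub>R lattice_char m \<theta>" for \<theta>
  proof -
    have "(\<Prod>b\<in>Basis. F b (\<theta> \<bullet> b)) =
        (\<Prod>j\<in>UNIV. of_real (indicator {-pi..pi} (\<theta> $ j)) * exp (\<i> * of_real (of_int (m $ j) * \<theta> $ j)))"
      by (simp add: prod_Basis_cart F_axis inner_axis scaleR_conv_of_real)
    also have "\<dots> = of_real (\<Prod>j\<in>UNIV. indicator {-pi..pi} (\<theta> $ j)) * lattice_char m \<theta>"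
      by (simp add: prod.distrib lattice_char_def exp_sum sum_distrib_left)
    also have "(\<Prod>j\<in>UNIV. indicator {-pi..pi} (\<theta> $ j)) = (indicator ?Q \<theta> :: real)"
      by (auto simp: indicator_def mem_box_cart intro!: prod_zero)
    finally show ?thesis
      by (simp add: scaleR_conv_of_real)
  qed
  have "set_integrable lborel ?Q (lattice_char m)"
    by (rule borel_integrable_compact[OF compact_cbox continuous_on_lattice_char, folded set_integrable_def])
  then have "integral ?Q (lattice_char m) = (LINT \<theta>:?Q|lborel. lattice_char m \<theta>)"
    by (simp add: set_borel_integral_eq_integral)
  also have "\<dots> = (\<integral>\<theta>. (\<Prod>b\<in>Basis. F b (\<theta> \<bullet> b)) \<partial>lborel)"
    by (simp add: set_lebesgue_integral_def eq)
  also have "\<dots> = (\<Prod>b\<in>Basis. \<integral>t. F b t \<partial>lborel)"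
    by (rule lborel_integral_prod_Basis) (rule int)
  also have "\<dots> = (\<Prod>j\<in>UNIV. \<integral>t. F (axis j 1) t \<partial>lborel)"
    by (rule prod_Basis_cart)
  also have "\<dots> = 0"
    using integral_exp_int_frequency[OF j]
    by (intro prod_zero) (auto simp: F_axis set_lebesgue_integral_def intro!: exI[of _ j])
  finally show ?thesis .
qed

text \<open>The left side is -h^2 times the discrete Helmholtz operator, which avoids division by
  h^2. The defect on the right is kept explicit because it carries the factor \<epsilon> that
  disappears in the limit.\<close>

lemma regularized_green_equation:
  fixes m :: "int ^ 'd"
  assumes "m \<noteq> 0" "\<epsilon> > 0"
  shows "(\<Sum>e\<in>unit_steps. regularized_green h k \<epsilon> (m + e) - regularized_green h k \<epsilon> m)
      + of_real (k\<^sup>2 * h\<^sup>2) * regularized_green h k \<epsilon> m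
      = \<i> * of_real \<epsilon> * regularized_green h k \<epsilon> m"
proof -
  let ?Q = "cbox (\<chi> i. - pi) (\<chi> i. pi) :: (real ^ 'd) set"
  define c :: complex where "c = 1 / of_real ((2 * pi) ^ CARD('d))"
  define D :: "real ^ 'd \<Rightarrow> complex"
    where "D \<theta> = of_real (lattice_symbol \<theta> - k\<^sup>2 * h\<^sup>2) + \<i> * of_real \<epsilon>" for \<theta>
  define I where "I n = integral ?Q (\<lambda>\<theta>. lattice_char n \<theta> / D \<theta>)" for n
  have green: "regularized_green h k \<epsilon> n = c * I n" for n :: "int ^ 'd"
    by (simp add: regularized_green_def c_def I_def D_def lattice_char_def)
  \<comment> \<open>The imaginary part of \<open>D\<close> is \<epsilon> > 0; this makes the
    integrand continuous on the cube even where the symbol equals k^2 h^2.\<close>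
  have D_nz: "D \<theta> \<noteq> 0" for \<theta>
    using assms(2) by (auto simp: D_def complex_eq_iff)
  have "continuous_on ?Q D"
    unfolding D_def lattice_symbol_def by (intro continuous_intros)
  then have int: "(\<lambda>\<theta>. lattice_char n \<theta> / D \<theta>) integrable_on ?Q" for n
    by (intro integrable_continuous continuous_intros) (auto simp: D_nz)
  \<comment> \<open>The coefficient is chosen so that, together with the symbol coming from the
    shifts, it adds up to -\<open>D\<close>. The denominator then cancels and only a character
    remains.\<close>
  have "(\<Sum>e\<in>unit_steps. I (m + e) - I m) + (of_real (k\<^sup>2 * h\<^sup>2) - \<i> * of_real \<epsilon>) * I m
      = integral ?Q (\<lambda>\<theta>. (\<Sum>e\<in>unit_steps. lattice_char (m + e) \<theta> / D \<theta> - lattice_char m \<theta> / D \<theta>)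
          + (of_real (k\<^sup>2 * h\<^sup>2) - \<i> * of_real \<epsilon>) * (lattice_char m \<theta> / D \<theta>))"
  proof (rule integral_unique[symmetric])
    show "((\<lambda>\<theta>. (\<Sum>e\<in>unit_steps. lattice_char (m + e) \<theta> / D \<theta> - lattice_char m \<theta> / D \<theta>)
          + (of_real (k\<^sup>2 * h\<^sup>2) - \<i> * of_real \<epsilon>) * (lattice_char m \<theta> / D \<theta>)) has_integral
        (\<Sum>e\<in>unit_steps. I (m + e) - I m) + (of_real (k\<^sup>2 * h\<^sup>2) - \<i> * of_real \<epsilon>) * I m) ?Q"
      unfolding I_def
      by (intro has_integral_add has_integral_sum has_integral_diff has_integral_mult_right
          integrable_integral int finite_unit_steps)
  qed
  also have "\<dots> = integral ?Q (\<lambda>\<theta>. - lattice_char m \<theta>)"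
  proof (rule integral_cong)
    fix \<theta>
    have "(\<Sum>e\<in>unit_steps. lattice_char (m + e) \<theta> / D \<theta> - lattice_char m \<theta> / D \<theta>)
        = - of_real (lattice_symbol \<theta>) * lattice_char m \<theta> / D \<theta>"
      by (simp only: diff_divide_distrib[symmetric] sum_divide_distrib[symmetric]
          sum_unit_steps_lattice_char)
    then have "(\<Sum>e\<in>unit_steps. lattice_char (m + e) \<theta> / D \<theta> - lattice_char m \<theta> / D \<theta>)
          + (of_real (k\<^sup>2 * h\<^sup>2) - \<i> * of_real \<epsilon>) * (lattice_char m \<theta> / D \<theta>)
        = - (D \<theta> * lattice_char m \<theta> / D \<theta>)"
      by (simp add: D_def add_divide_distrib diff_divide_distrib algebra_simps)
    then show "(\<Sum>e\<in>unit_steps. lattice_char (m + e) \<theta> / D \<theta> - lattice_char m \<theta> / D \<theta>)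
          + (of_real (k\<^sup>2 * h\<^sup>2) - \<i> * of_real \<epsilon>) * (lattice_char m \<theta> / D \<theta>) = - lattice_char m \<theta>"
      by (simp add: D_nz)
  qed
  also have "\<dots> = 0"
    using integral_lattice_char[OF assms(1)] by simp
  finally have "c * ((\<Sum>e\<in>unit_steps. I (m + e) - I m)
      + (of_real (k\<^sup>2 * h\<^sup>2) - \<i> * of_real \<epsilon>) * I m) = 0"
    by simp
  then show ?thesis
    by (simp add: green sum_distrib_left algebra_simps)
qed

text \<open>The regularized equation involves finitely many nodes, so limits may be taken term by
  term; its right side is \<epsilon> times a convergent quantity and tends to 0.\<close>

lemma discrete_helmholtz_lattice_green:
  fixes m :: "int ^ 'd"
  assumes "m \<noteq> 0" "h > 0" "green_limit_exists TYPE('d) h k"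
  shows "discrete_helmholtz h k (lattice_green h k) m = 0"
proof -
  let ?R = "regularized_green h k" and ?G = "lattice_green h k"
  have lim: "((\<lambda>\<epsilon>. ?R \<epsilon> n) \<longlongrightarrow> ?G n) (at_right 0)" for n :: "int ^ 'd"
    using assms(3) unfolding green_limit_exists_def lattice_green_def
    by (metis tendsto_Lim trivial_limit_at_right_real)
  have "((\<lambda>\<epsilon>. (\<Sum>e\<in>unit_steps. ?R \<epsilon> (m + e) - ?R \<epsilon> m) + of_real (k\<^sup>2 * h\<^sup>2) * ?R \<epsilon> m)
      \<longlongrightarrow> (\<Sum>e\<in>unit_steps. ?G (m + e) - ?G m) + of_real (k\<^sup>2 * h\<^sup>2) * ?G m) (at_right 0)"
    by (intro tendsto_intros lim)
  moreover have "((\<lambda>\<epsilon>. (\<Sum>e\<in>unit_steps. ?R \<epsilon> (m + e) - ?R \<epsilon> m) + of_real (k\<^sup>2 * h\<^sup>2) * ?R \<epsilon> m)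
      \<longlongrightarrow> \<i> * of_real 0 * ?G m) (at_right 0)"
  proof (rule Lim_transform_eventually)
    show "((\<lambda>\<epsilon>. \<i> * of_real \<epsilon> * ?R \<epsilon> m) \<longlongrightarrow> \<i> * of_real 0 * ?G m) (at_right 0)"
      by (intro tendsto_intros lim)
    show "\<forall>\<^sub>F \<epsilon> in at_right 0. \<i> * of_real \<epsilon> * ?R \<epsilon> m =
        (\<Sum>e\<in>unit_steps. ?R \<epsilon> (m + e) - ?R \<epsilon> m) + of_real (k\<^sup>2 * h\<^sup>2) * ?R \<epsilon> m"
      using eventually_at_right_less[of 0]
      by eventually_elim (rule regularized_green_equation[OF assms(1), symmetric])
  qed
  ultimately have "(\<Sum>e\<in>unit_steps. ?G (m + e) - ?G m) + of_real (k\<^sup>2 * h\<^sup>2) * ?G m = 0"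
    using tendsto_unique[OF trivial_limit_at_right_real] by fastforce
  then have "(\<Sum>e\<in>unit_steps. ?G (m + e) - ?G m) = - (of_real (k\<^sup>2 * h\<^sup>2) * ?G m)"
    by (simp add: eq_neg_iff_add_eq_0)
  then show ?thesis
    using assms(2) by (simp add: discrete_helmholtz_def)
qed

section \<open>Outgoing solutions\<close>

text \<open>Different sources have different supports; a common finite index set makes their
  convolutions comparable term by term.\<close>

lemma outgoing_solution_superset:
  assumes "finite A" "lattice_support f \<subseteq> A"
  shows "outgoing_solution h k f m = (\<Sum>n\<in>A. of_real (h\<^sup>2) * lattice_green h k (m - n) * f n)"
proof -
  have "(\<Sum>n\<in>lattice_support f. lattice_green h k (m - n) * f n)
      = (\<Sum>n\<in>A. lattice_green h k (m - n) * f n)"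
    using assms by (intro sum.mono_neutral_left) (auto simp: lattice_support_def)
  then show ?thesis
    by (simp add: outgoing_solution_def sum_distrib_left mult.assoc)
qed

lemma discrete_helmholtz_sum:
  "discrete_helmholtz h k (\<lambda>m. \<Sum>n\<in>A. c n * w n m) m = (\<Sum>n\<in>A. c n * discrete_helmholtz h k (w n) m)"
proof -
  have "(\<Sum>e\<in>unit_steps. (\<Sum>n\<in>A. c n * w n (m + e)) - (\<Sum>n\<in>A. c n * w n m))
      = (\<Sum>n\<in>A. c n * (\<Sum>e\<in>unit_steps. w n (m + e) - w n m))"
    by (simp add: sum_subtractf[symmetric] sum_distrib_left right_diff_distrib)
      (rule sum.swap)
  then show ?thesis
    by (simp add: discrete_helmholtz_def sum_distrib_left sum_subtractf[symmetric] sum_negf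
        algebra_simps)
qed

lemma discrete_helmholtz_shift:
  "discrete_helmholtz h k (\<lambda>m. v (m - n)) m = discrete_helmholtz h k v (m - n)"
  by (simp add: discrete_helmholtz_def diff_add_eq)

text \<open>Superposition: the solution combines translates of the Green's function, each
  homogeneous away from its own source node.\<close>

lemma discrete_helmholtz_outgoing_solution:
  fixes f :: "int ^ 'd \<Rightarrow> complex"
  assumes "h > 0" "green_limit_exists TYPE('d) h k" "finite (lattice_support f)"
    and "m \<notin> lattice_support f"
  shows "discrete_helmholtz h k (outgoing_solution h k f) m = 0"
proof -
  have "outgoing_solution h k f =
      (\<lambda>m. \<Sum>n\<in>lattice_support f. (of_real (h\<^sup>2) * f n) * lattice_green h k (m - n))"
    by (simp add: fun_eq_iff outgoing_solution_superset[OF assms(3) order_refl] mult_ac)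
  then have "discrete_helmholtz h k (outgoing_solution h k f) m =
      (\<Sum>n\<in>lattice_support f. of_real (h\<^sup>2) * f n * discrete_helmholtz h k (lattice_green h k) (m - n))"
    by (simp add: discrete_helmholtz_sum discrete_helmholtz_shift)
  also have "\<dots> = 0"
  proof (rule sum.neutral, rule ballI)
    fix n
    assume "n \<in> lattice_support f"
    then have "m - n \<noteq> 0"
      using assms(4) by auto
    then show "of_real (h\<^sup>2) * f n * discrete_helmholtz h k (lattice_green h k) (m - n) = 0"
      by (simp add: discrete_helmholtz_lattice_green assms(1,2))
  qed
  finally show ?thesis .
qed

section \<open>Lattice geometry\<close>

lemma finite_bounded_int_vec:
  fixes S :: "(int ^ 'd) set"
  assumes "\<And>m i. m \<in> S \<Longrightarrow> \<bar>m $ i\<bar> \<le> K"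
  shows "finite S"
proof -
  have "S \<subseteq> vec_lambda ` (\<Pi>\<^sub>E i\<in>UNIV. {-K..K})"
  proof
    fix m assume "m \<in> S"
    then have "vec_nth m \<in> (\<Pi>\<^sub>E i\<in>UNIV. {-K..K})"
      using assms by (auto simp: abs_le_iff minus_le_iff)
    then show "m \<in> vec_lambda ` (\<Pi>\<^sub>E i\<in>UNIV. {-K..K})"
      by (metis imageI vec_nth_inverse)
  qed
  then show ?thesis
    by (rule finite_subset) (intro finite_imageI finite_PiE; simp)
qed

text \<open>Spacing \<open>h\<close> > 0 turns the bound on the domain into a bound on integer
  coordinates. This makes \<open>gamma_minus\<close>, the index set of the boundary matrix,
  finite.\<close>

lemma finite_M_plus:
  assumes "h > 0" "bounded \<Omega>"
  shows "finite (M_plus h \<Omega>)"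
proof -
  obtain B where B: "\<And>x. x \<in> \<Omega> \<Longrightarrow> norm x \<le> B"
    using assms(2) by (auto simp: bounded_iff)
  show ?thesis
  proof (rule finite_bounded_int_vec)
    fix m i
    assume "m \<in> M_plus h \<Omega>"
    then have "\<bar>lattice_node h m $ i\<bar> \<le> B"
      using B component_le_norm_cart order_trans by (fastforce simp: M_plus_def)
    then have "h * \<bar>of_int (m $ i)\<bar> \<le> B"
      using assms(1) by (simp add: lattice_node_def abs_mult)
    then have "\<bar>of_int (m $ i)\<bar> \<le> B / h"
      using assms(1) by (simp add: field_simps)
    then show "\<bar>m $ i\<bar> \<le> \<lfloor>B / h\<rfloor>"
      by (simp add: le_floor_iff)
  qed
qed

lemma finite_stencil_nodes:
  assumes "finite M"
  shows "finite (stencil_nodes M)"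
proof -
  have "{m + e | m e. m \<in> M \<and> e \<in> unit_steps} = (\<lambda>(m, e). m + e) ` (M \<times> unit_steps)"
    by auto
  then show ?thesis
    using assms by (simp add: stencil_nodes_def finite_unit_steps)
qed

lemma M_plus_Int_M_minus: "M_plus h \<Omega> \<inter> M_minus h \<Omega> = {}"
  using closure_subset by (auto simp: M_plus_def M_minus_def)

lemma gamma_minus_subset: "gamma_minus h \<Omega> \<subseteq> N_plus h \<Omega>" "gamma_minus h \<Omega> \<subseteq> M_minus h \<Omega>"
  by (auto simp: gamma_minus_def boundary_strip_def)

section \<open>Uniqueness for the interior problem and inversion of the boundary matrix\<close>

lemma discrete_helmholtz_restrict:
  assumes "m \<in> M"
  shows "discrete_helmholtz h k (restrict v (stencil_nodes M)) m = discrete_helmholtz h k v m"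
proof -
  have "m \<in> stencil_nodes M" "\<And>e. e \<in> unit_steps \<Longrightarrow> m + e \<in> stencil_nodes M"
    using assms by (auto simp: stencil_nodes_def)
  then show ?thesis
    by (simp add: discrete_helmholtz_def)
qed

lemma interior_dirichlet_unique:
  assumes "interior_dirichlet_uniquely_solvable h k \<Omega>"
    and "\<And>m. m \<in> M_plus h \<Omega> \<Longrightarrow> discrete_helmholtz h k v m = 0"
    and "\<And>m. m \<in> M_plus h \<Omega> \<Longrightarrow> discrete_helmholtz h k w m = 0"
    and "\<And>m. m \<in> gamma_minus h \<Omega> \<Longrightarrow> v m = w m"
    and "m \<in> N_plus h \<Omega>"
  shows "v m = w m"
proof -
  let ?N = "N_plus h \<Omega>"
  have "restrict v ?N = restrict w ?N"
  \<comment> \<open>The prescribed data are the values of \<open>w\<close> itself: the restrictions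
    of \<open>w\<close> and of \<open>v\<close> to \<open>N_plus\<close> both solve this one
    problem.\<close>
  proof (rule ex1E[OF assms(1)[unfolded interior_dirichlet_uniquely_solvable_def, rule_format, of w]])
    fix u
    assume unique: "\<forall>y. y \<in> extensional ?N \<and> (\<forall>m\<in>M_plus h \<Omega>. discrete_helmholtz h k y m = 0) \<and>
        (\<forall>m\<in>gamma_minus h \<Omega>. y m = w m) \<longrightarrow> y = u"
    have "restrict v ?N = u" "restrict w ?N = u"
      using assms(2-4) gamma_minus_subset(1)[of h \<Omega>]
      by (auto intro!: unique[rule_format] simp: N_plus_def discrete_helmholtz_restrict subset_iff)
    then show ?thesis
      by simp
  qed
  then show ?thesis
    using assms(5) by (metis restrict_apply')
qed

lemma matrix_vec_on_inverse:
  assumes "nonsingular_on I A" "finite I" "i \<in> I"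
  shows "(\<Sum>j\<in>I. A i j * matrix_vec_on I (matrix_inv_on I A) x j) = x i"
proof -
  let ?B = "matrix_inv_on I A"
  \<comment> \<open>Nonsingularity provides the witness that makes the choice in
    \<open>matrix_inv_on\<close> a genuine inverse.\<close>
  have "inverse_matrix_on I A ?B"
    using assms(1) unfolding nonsingular_on_def matrix_inv_on_def by (rule someI_ex)
  then have AB: "(\<Sum>j\<in>I. A i j * ?B j l) = (if i = l then 1 else 0)" if "l \<in> I" for l
    using assms(3) that by (simp add: inverse_matrix_on_def)
  have "(\<Sum>j\<in>I. A i j * matrix_vec_on I ?B x j) = (\<Sum>j\<in>I. \<Sum>l\<in>I. A i j * ?B j l * x l)"
    by (simp add: matrix_vec_on_def sum_distrib_left mult.assoc)
  also have "\<dots> = (\<Sum>l\<in>I. (\<Sum>j\<in>I. A i j * ?B j l) * x l)"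
    by (subst sum.swap) (simp add: sum_distrib_right)
  also have "\<dots> = (\<Sum>l\<in>I. if i = l then x l else 0)"
    by (rule sum.cong) (auto simp: AB)
  also have "\<dots> = x i"
    using assms by simp
  finally show ?thesis .
qed

theorem theorem6p1:
  fixes h k :: real
    and \<Omega> :: "(real ^ 'd) set"
    and f_minus f_plus u_minus \<xi> lam v g u_tilde :: "int ^ 'd \<Rightarrow> complex"
  assumes dim: "CARD('d) \<in> {2, 3}"
    and h_pos: "h > 0" and k_pos: "k > 0"
    and domain: "bounded_lipschitz_domain \<Omega>"
    and no_boundary_node: "\<And>m. lattice_node h m \<notin> frontier \<Omega>"
    and green: "green_limit_exists TYPE('d) h k"
    and nonsingular: "nonsingular_on (gamma_minus h \<Omega>) (S_minus_minus h k)"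
    and dirichlet: "interior_dirichlet_uniquely_solvable h k \<Omega>"
    and finite_source: "finite (lattice_support f_minus)"
    and exterior_source: "lattice_support f_minus \<subseteq> M_minus h \<Omega>"
    and no_interior_source: "f_plus = (\<lambda>_. 0)"
    and u_minus: "u_minus = outgoing_solution h k f_minus"
    and xi: "\<xi> = restrict u_minus (gamma_minus h \<Omega>)"
    and lam: "lam = matrix_vec_on (gamma_minus h \<Omega>)
                      (matrix_inv_on (gamma_minus h \<Omega>) (S_minus_minus h k)) \<xi>"
    and v: "v = outgoing_solution h k lam"
    and g: "g = (\<lambda>m. if m \<in> gamma_minus h \<Omega> then - lam m else 0)"
    and u_tilde: "u_tilde = outgoing_solution h k (\<lambda>m. f_minus m + g m)"
  shows "(\<forall>m\<in>N_plus h \<Omega>. v m = u_minus m) \<and> (\<forall>m\<in>N_plus h \<Omega>. u_tilde m = 0)"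
proof -
  let ?\<gamma> = "gamma_minus h \<Omega>"
  have "bounded \<Omega>"
    using domain by (simp add: bounded_lipschitz_domain_def)
  then have "finite (N_plus h \<Omega>)"
    using h_pos by (simp add: N_plus_def finite_stencil_nodes finite_M_plus)
  then have fin: "finite ?\<gamma>"
    using gamma_minus_subset(1) finite_subset by blast
  \<comment> \<open>This is the extension by zero built into \<open>matrix_vec_on\<close>.\<close>
  have lam_supp: "lattice_support lam \<subseteq> ?\<gamma>"
    by (auto simp: lattice_support_def lam matrix_vec_on_def split: if_splits)
  have v_eq: "v m = u_minus m" if "m \<in> N_plus h \<Omega>" for m
  proof (rule interior_dirichlet_unique[OF dirichlet _ _ _ that])
    fix m
    assume "m \<in> M_plus h \<Omega>"
    then have "m \<notin> M_minus h \<Omega>"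
      using M_plus_Int_M_minus by blast
    then have "m \<notin> lattice_support lam" "m \<notin> lattice_support f_minus"
      using lam_supp gamma_minus_subset(2) exterior_source by blast+
    then show "discrete_helmholtz h k v m = 0" "discrete_helmholtz h k u_minus m = 0"
      unfolding v u_minus
      using finite_source finite_subset[OF lam_supp fin]
      by (simp_all add: discrete_helmholtz_outgoing_solution[OF h_pos green])
  next
    fix m
    assume m: "m \<in> ?\<gamma>"
    \<comment> \<open>On the strip, evaluating the convolution is multiplication by a row of the
      boundary matrix.\<close>
    have "v m = (\<Sum>n\<in>?\<gamma>. S_minus_minus h k m n * lam n)"
      by (simp add: v outgoing_solution_superset[OF fin lam_supp] S_minus_minus_def)
    also have "\<dots> = \<xi> m"
      unfolding lam by (rule matrix_vec_on_inverse[OF nonsingular fin m])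
    finally show "v m = u_minus m"
      by (simp add: xi m)
  qed
  have "g = (\<lambda>m. - lam m)"
    using lam_supp by (auto simp: g fun_eq_iff lattice_support_def)
  \<comment> \<open>\<open>A\<close> contains the supports of \<open>f_minus\<close>,
    \<open>lam\<close> and \<open>f_minus + g\<close>. Cancellation may shrink the last one, so
    linearity of the convolution is read off from sums over \<open>A\<close>.\<close>
  moreover define A where "A = lattice_support f_minus \<union> ?\<gamma>"
  ultimately have "u_tilde m = u_minus m - v m" for m
    using fin finite_source lam_supp
    unfolding u_tilde u_minus v
    by (subst (1 2 3) outgoing_solution_superset[of A])
      (auto simp: A_def lattice_support_def sum_subtractf[symmetric] right_diff_distrib)
  then show ?thesis
    using v_eq by simp
qed

end
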